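(* For $n\ge1$ let $P^B_n(x_0,x_1,y_0,y_1)=\sum_{\sigma\in\mathcal{B}_n}x_0^{\mathrm{asc}_0\sigma}x_1^{\mathrm{asc}_1\sigma}y_0^{\mathrm{des}_0\sigma}y_1^{\mathrm{des}_1\sigma}$ and $\alpha=(y_0-x_0)(y_1-x_1)$. Then $$\sum_{n\geq 1}P^B_{2n}(x_0, x_1, y_0, y_1)\frac{t^{2n}}{(2n)!}=\frac{(x_0y_1+x_1y_0)\sum_{n\geq 0}\frac{\alpha^n (2t)^{2n}}{(2n)!}+\sum_{n\geq 0}\frac{\alpha^{n+1} t^{2n}}{(2n)!}-(x_1x_0+y_0y_1)}{(x_0x_1+y_0y_1)-(y_1x_0+x_1y_0)\sum_{n\geq 0}\frac{\alpha^n (2t)^{2n}}{(2n)!}},$$ and $$\sum_{n\geq 1}P^B_{2n-1}(x_0, x_1, y_0, y_1)\frac{t^{2n-1}}{(2n-1)!}=\frac{(y_0^2-x_0^2)(y_1-x_1)\,\sum_{n\geq 0}\frac{\alpha^{n} t^{2n+1}}{(2n+1)!}}{(x_0x_1+y_0y_1)-(x_0y_1+x_1y_0)\sum_{n\geq 0}\frac{\alpha^n (2t)^{2n}}{(2n)!}}.$$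
   Context: $\mathcal{B}_n$ is the set of signed permutations, i.e. bijections $\sigma$ of $\{\pm1,\dots,\pm n\}$ with $\sigma(-i)=-\sigma(i)$; each $\sigma$ is identified with the word $\sigma(0)\sigma(1)\cdots\sigma(n)$ where $\sigma(0)=0$. A position $i\in\{0,1,\dots,n-1\}$ is a descent if $\sigma(i)>\sigma(i+1)$ and an ascent if $\sigma(i)<\sigma(i+1)$. $\mathrm{des}_1\sigma,\mathrm{des}_0\sigma$ are the numbers of descents at odd, resp. even (including $0$), positions; $\mathrm{asc}_1\sigma,\mathrm{asc}_0\sigma$ likewise for ascents. *)

theory Defs
  imports
    "HOL-Computational_Algebra.Formal_Power_Series"
    "HOL-Combinatorics.Permutations"
begin

text \<open>
  The predicate \<^const>\<open>permutes\<close> makes a signed permutation the identity outside of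
  \<open>{\<plusminus>1, \<dots>, \<plusminus>n}\<close>; this makes the set finite and gives the convention \<open>\<sigma> 0 = 0\<close>.
\<close>

definition signed_perms :: "nat \<Rightarrow> (int \<Rightarrow> int) set" where
  "signed_perms n =
    {\<sigma>. \<sigma> permutes ({- int n..int n} - {0}) \<and>
         (\<forall>i \<in> {- int n..int n} - {0}. \<sigma> (- i) = - \<sigma> i)}"

definition is_descent :: "(int \<Rightarrow> int) \<Rightarrow> nat \<Rightarrow> bool" where
  "is_descent \<sigma> i \<longleftrightarrow> \<sigma> (int i) > \<sigma> (int (i + 1))"

definition is_ascent :: "(int \<Rightarrow> int) \<Rightarrow> nat \<Rightarrow> bool" where
  "is_ascent \<sigma> i \<longleftrightarrow> \<sigma> (int i) < \<sigma> (int (i + 1))"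

definition des0 :: "nat \<Rightarrow> (int \<Rightarrow> int) \<Rightarrow> nat" where
  "des0 n \<sigma> = card {i \<in> {0..<n}. even i \<and> is_descent \<sigma> i}"

definition des1 :: "nat \<Rightarrow> (int \<Rightarrow> int) \<Rightarrow> nat" where
  "des1 n \<sigma> = card {i \<in> {0..<n}. odd i \<and> is_descent \<sigma> i}"

definition asc0 :: "nat \<Rightarrow> (int \<Rightarrow> int) \<Rightarrow> nat" where
  "asc0 n \<sigma> = card {i \<in> {0..<n}. even i \<and> is_ascent \<sigma> i}"

definition asc1 :: "nat \<Rightarrow> (int \<Rightarrow> int) \<Rightarrow> nat" where
  "asc1 n \<sigma> = card {i \<in> {0..<n}. odd i \<and> is_ascent \<sigma> i}"

definition PB :: "nat \<Rightarrow> 'a \<Rightarrow> 'a \<Rightarrow> 'a \<Rightarrow> 'a \<Rightarrow> 'a :: comm_semiring_1" where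
  "PB n x0 x1 y0 y1 =
    (\<Sum>\<sigma> \<in> signed_perms n.
       x0 ^ asc0 n \<sigma> * x1 ^ asc1 n \<sigma> * y0 ^ des0 n \<sigma> * y1 ^ des1 n \<sigma>)"

text \<open>
  The series \<open>\<Sum>n. a (2 * n) * t ^ (2 * n)\<close> and \<open>\<Sum>n. a (2 * n + 1) * t ^ (2 * n + 1)\<close>:
  the sequence \<open>a\<close> is indexed by the exponent of \<open>t\<close>.
\<close>

definition even_series :: "(nat \<Rightarrow> 'a) \<Rightarrow> 'a :: zero fps" where
  "even_series a = Abs_fps (\<lambda>m. if even m then a m else 0)"

definition odd_series :: "(nat \<Rightarrow> 'a) \<Rightarrow> 'a :: zero fps" where
  "odd_series a = Abs_fps (\<lambda>m. if odd m then a m else 0)"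

end

theory Submission
  imports Defs
begin

text \<open>
  Write the weight \<open>y\<close> of a descent as \<open>x + (y - x)\<close> and expand: every position is either free, with
  weight \<open>x\<close>, or a forced descent, with weight \<open>y - x\<close>. Splitting off the last maximal block of
  forced descents, whose entries form a \<open>k\<close>-subset with \<open>2 ^ k\<close> choices of signs, gives a linear
  recurrence for \<open>PB\<close>; the block containing position \<open>0\<close> has all its entries negative and gives the
  inhomogeneous term. The block weights depend only on parities, so the recurrence is a
  \<open>2 \<times> 2\<close> linear system for the even and odd generating functions, whose coefficients are
  \<open>cosh (2 \<surd>\<alpha> t)\<close> and \<open>sinh (2 \<surd>\<alpha> t) / \<surd>\<alpha>\<close>. Cramer's rule and the addition formulas solve it.

  Words are read from right to left, so that the last letter is the head of the list and the position
  of a comparison is the length of the tail.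
\<close>

unbundle fps_syntax

section \<open>Weighted signed words\<close>

text \<open>The ground set is arbitrary because removing a block of letters leaves words over the
  remaining absolute values.\<close>

definition signed_words :: "int set \<Rightarrow> int list set" where
  "signed_words S = {w. distinct (map abs w) \<and> abs ` set w = S}"

text \<open>The appended 0 plays the role of \<open>\<sigma> 0 = 0\<close> at position 0. For
  \<open>signed_words S\<close> with \<open>S\<close> positive, neighbouring letters never tie, so
  the \<open>else\<close> branch means an ascent.\<close>

fun word_weight :: "(nat \<Rightarrow> 'a) \<Rightarrow> (nat \<Rightarrow> 'a) \<Rightarrow> int list \<Rightarrow> 'a :: comm_ring_1" where
  "word_weight x y [] = 1"
| "word_weight x y (a # w) =
    (if a < hd (w @ [0]) then y (length w) else x (length w)) * word_weight x y w"

definition total_weight :: "(nat \<Rightarrow> 'a) \<Rightarrow> (nat \<Rightarrow> 'a) \<Rightarrow> int set \<Rightarrow> 'a :: comm_ring_1" where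
  "total_weight x y S = (\<Sum>w \<in> signed_words S. word_weight x y w)"

section \<open>Expansion of the weight of a single word into forced and free positions\<close>

lemma sorted_wrt_less_Cons_hd:
  fixes a :: "'a :: linorder"
  assumes "w \<noteq> []"
  shows "sorted_wrt (<) (a # w) \<longleftrightarrow> a < hd w \<and> sorted_wrt (<) w"
  using assms by (cases w) auto

text \<open>The block consists of the first \<open>k\<close> letters of the list: its
  \<open>k - 1\<close> inner comparisons are forced descents, and the comparison of the block with
  the next letter, at position \<open>length w - k\<close>, is free. In the final summand every
  position down to 0 is forced, so the appended 0 belongs to the chain.\<close>

lemma word_weight_expand:
  "word_weight x y w =
    (\<Sum>k = 1..length w. if sorted_wrt (<) (take k w)
       then (\<Prod>i \<in> {length w - k<..<length w}. y i - x i) * x (length w - k)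
              * word_weight x y (drop k w) else 0)
    + (if sorted_wrt (<) (w @ [0]) then \<Prod>i<length w. y i - x i else 0)"
proof (induction w)
  case Nil
  then show ?case by simp
next
  case (Cons a w)
  let ?n = "length w" and ?d = "\<lambda>i. y i - x i"
  let ?t = "\<lambda>w k. if sorted_wrt (<) (take k w)
       then (\<Prod>i \<in> {length w - k<..<length w}. ?d i) * x (length w - k)
              * word_weight x y (drop k w) else 0"
  let ?c = "if a < hd (w @ [0]) then ?d ?n else 0"
  \<comment> \<open>A forced descent put in front of a block of length \<open>k\<close> gives a
    block of length \<open>Suc k\<close>; the factor \<open>?c\<close> is its weight.\<close>
  have shift: "?t (a # w) (Suc k) = ?c * ?t w k" if k: "k \<in> {1..?n}" for k
  proof -
    have ne: "take k w \<noteq> []" and hd: "hd (take k w) = hd (w @ [0])"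
      using k by (cases w; cases k; auto)+
    have "{?n - k<..<Suc ?n} = insert ?n {?n - k<..<?n}" using k by auto
    then show ?thesis
      unfolding take_Suc_Cons sorted_wrt_less_Cons_hd[OF ne] hd by (auto simp: mult_ac)
  qed
  have "(\<Sum>k = 1..length (a # w). ?t (a # w) k)
      = ?t (a # w) 1 + (\<Sum>k = 1..?n. ?t (a # w) (Suc k))"
    by (subst sum.atLeast_Suc_atMost)
      (simp_all only: sum.shift_bounds_cl_Suc_ivl length_Cons One_nat_def Suc_le_mono le0)
  also have "(\<Sum>k = 1..?n. ?t (a # w) (Suc k)) = ?c * (\<Sum>k = 1..?n. ?t w k)"
    unfolding sum_distrib_left by (rule sum.cong[OF refl shift])
  \<comment> \<open>A block of length 1 has no forced position: the newest comparison is the free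
    one.\<close>
  also have "?t (a # w) 1 = x ?n * word_weight x y w"
  proof -
    have "{?n<..<Suc ?n} = {}" by auto
    then show ?thesis by simp
  qed
  finally have sum: "(\<Sum>k = 1..length (a # w). ?t (a # w) k)
      = x ?n * word_weight x y w + ?c * (\<Sum>k = 1..?n. ?t w k)" .
  have last: "(if sorted_wrt (<) ((a # w) @ [0]) then \<Prod>i<length (a # w). ?d i else 0)
      = ?c * (if sorted_wrt (<) (w @ [0]) then \<Prod>i<?n. ?d i else 0)"
    using sorted_wrt_less_Cons_hd[of "w @ [0]" a] by (simp add: mult_ac)
  \<comment> \<open>The factor of the newest comparison is split as \<open>x ?n + ?c\<close>; only
    the \<open>?c\<close> part is expanded further.\<close>
  have "word_weight x y (a # w) = x ?n * word_weight x y w + ?c * word_weight x y w"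
    by (simp add: algebra_simps)
  also have "?c * word_weight x y w = ?c * (\<Sum>k = 1..?n. ?t w k)
      + ?c * (if sorted_wrt (<) (w @ [0]) then \<Prod>i<?n. ?d i else 0)"
    by (subst Cons.IH) (rule distrib_left)
  finally show ?case unfolding sum last by (simp only: add.assoc)
qed

section \<open>Sums over signed words and the recurrence for the total weight\<close>

lemma length_signed_words: "w \<in> signed_words S \<Longrightarrow> length w = card S"
  unfolding signed_words_def
  by (metis (mono_tags, lifting) distinct_card length_map list.set_map mem_Collect_eq)

lemma finite_signed_words:
  assumes "finite S"
  shows "finite (signed_words S)"
proof (rule finite_subset)
  show "signed_words S \<subseteq> {w. set w \<subseteq> S \<union> uminus ` S \<and> length w = card S}"
  proof clarify
    fix w assume w: "w \<in> signed_words S"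
    have "a \<in> S \<union> uminus ` S" if "a \<in> set w" for a
    proof -
      have "\<bar>a\<bar> \<in> S" using w that by (auto simp: signed_words_def)
      then show ?thesis by (cases "a < 0") (auto simp: image_iff intro!: bexI[of _ "- a"])
    qed
    then show "set w \<subseteq> S \<union> uminus ` S \<and> length w = card S"
      using w by (auto simp: length_signed_words)
  qed
  show "finite {w. set w \<subseteq> S \<union> uminus ` S \<and> length w = card S}"
    using assms by (intro finite_lists_length_eq) auto
qed

text \<open>An increasing word is determined by its set of letters, hence by the set
  \<open>N\<close> of absolute values that carry a minus sign. Positivity keeps \<open>T\<close> and
  its negatives disjoint, so \<open>N\<close> can be read off the word.\<close>

lemma card_increasing_signed_words:
  assumes fin: "finite T" and pos: "T \<subseteq> {0<..}"
  shows "card {u \<in> signed_words T. sorted_wrt (<) u} = 2 ^ card T"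
proof -
  have abs_T: "\<bar>a\<bar> = a" if "a \<in> T" for a
    using that pos by auto
  have neg: "- a \<notin> T" if "a \<in> T" for a
  proof
    assume "- a \<in> T"
    then have "0 < - a" "0 < a" using that pos by auto
    then show False by simp
  qed
  let ?f = "\<lambda>N. sorted_list_of_set ((T - N) \<union> uminus ` N)"
  have setf: "set (?f N) = (T - N) \<union> uminus ` N" if "N \<subseteq> T" for N
    using that fin finite_subset by (subst set_sorted_list_of_set) auto
  have "bij_betw ?f (Pow T) {u \<in> signed_words T. sorted_wrt (<) u}"
  proof (rule bij_betw_byWitness[where f' = "\<lambda>u. {a \<in> T. - a \<in> set u}"])
    show "\<forall>N \<in> Pow T. {a \<in> T. - a \<in> set (?f N)} = N"
    proof
      fix N assume "N \<in> Pow T"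
      then have "N \<subseteq> T" by simp
      then show "{a \<in> T. - a \<in> set (?f N)} = N" unfolding setf[OF \<open>N \<subseteq> T\<close>] using neg by auto
    qed
    show "\<forall>u \<in> {u \<in> signed_words T. sorted_wrt (<) u}. ?f {a \<in> T. - a \<in> set u} = u"
    proof
      fix u assume "u \<in> {u \<in> signed_words T. sorted_wrt (<) u}"
      then have inj: "inj_on abs (set u)" and im: "abs ` set u = T" and srt: "sorted_wrt (<) u"
        by (auto simp: signed_words_def distinct_map)
      have "(T - {a \<in> T. - a \<in> set u}) \<union> uminus ` {a \<in> T. - a \<in> set u} = set u" (is "?L = _")
      proof
        show "?L \<subseteq> set u" using im by (auto simp: abs_if split: if_splits)
        show "set u \<subseteq> ?L"
        proof
          fix b assume b: "b \<in> set u"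
          then have bT: "\<bar>b\<bar> \<in> T" using im by auto
          then have "b \<noteq> 0" using pos by auto
          show "b \<in> ?L"
          proof (cases "b > 0")
            case True
            then have "- b \<notin> set u" using b inj by (auto dest!: inj_onD[of _ _ b "- b"])
            then show ?thesis using True bT by auto
          next
            case False
            then have "- b \<in> T" using bT \<open>b \<noteq> 0\<close> by auto
            then show ?thesis using b by (auto simp: image_iff intro!: bexI[of _ "- b"])
          qed
        qed
      qed
      then show "?f {a \<in> T. - a \<in> set u} = u"
        using srt by (simp add: sorted_list_of_set.idem_if_sorted_distinct strict_sorted_iff)
    qed
    show "?f ` Pow T \<subseteq> {u \<in> signed_words T. sorted_wrt (<) u}"
    proof clarify
      fix N assume N: "N \<subseteq> T"
      have "inj_on abs ((T - N) \<union> uminus ` N)"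
        \<comment> \<open>The left inverse of \<open>abs\<close> restores the signs recorded in
          \<open>N\<close>.\<close>
        using N by (intro inj_on_inverseI[of _ "\<lambda>a. if a \<in> N then - a else a"])
          (auto simp: abs_T subsetD)
      moreover have "abs ` ((T - N) \<union> uminus ` N) = T"
        using N abs_T by (auto simp: image_Un image_image subsetD)
      ultimately show "?f N \<in> signed_words T \<and> sorted_wrt (<) (?f N)"
        unfolding signed_words_def mem_Collect_eq distinct_map setf[OF N] by simp
    qed
    show "(\<lambda>u. {a \<in> T. - a \<in> set u}) ` {u \<in> signed_words T. sorted_wrt (<) u} \<subseteq> Pow T"
      by auto
  qed
  then have "card {u \<in> signed_words T. sorted_wrt (<) u} = card (Pow T)"
    by (simp add: bij_betw_same_card)
  then show ?thesis using fin by (simp add: card_Pow)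
qed

text \<open>The final 0 forces every letter to be negative, after which the order leaves no
  choice.\<close>

lemma increasing_negative_signed_words:
  assumes fin: "finite S" and pos: "S \<subseteq> {0<..}"
  shows "{w \<in> signed_words S. sorted_wrt (<) (w @ [0])} = {sorted_list_of_set (uminus ` S)}"
proof (intro equalityI subsetI)
  fix w assume "w \<in> {w \<in> signed_words S. sorted_wrt (<) (w @ [0])}"
  then have im: "abs ` set w = S" and srt: "sorted_wrt (<) w" and neg: "\<forall>a \<in> set w. a < 0"
    by (auto simp: signed_words_def sorted_wrt_append)
  have "uminus ` S = set w" using neg unfolding im[symmetric] by (force simp: image_image)
  then show "w \<in> {sorted_list_of_set (uminus ` S)}"
    using srt by (simp add: sorted_list_of_set.idem_if_sorted_distinct strict_sorted_iff)
next
  fix w assume "w \<in> {sorted_list_of_set (uminus ` S)}"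
  then have w: "w = sorted_list_of_set (uminus ` S)" by simp
  then have set: "set w = uminus ` S" and srt: "sorted_wrt (<) w" using fin by auto
  have "inj_on abs (uminus ` S)"
    using pos by (intro inj_on_inverseI[of _ uminus]) (auto dest!: subsetD)
  moreover have "abs ` uminus ` S = S" using pos by (force simp: image_image)
  ultimately show "w \<in> {w \<in> signed_words S. sorted_wrt (<) (w @ [0])}"
    using srt pos by (auto simp: signed_words_def sorted_wrt_append distinct_map set strict_sorted_iff)
qed

text \<open>The words are sorted by the set \<open>T\<close> of absolute values in their prefix of
  length \<open>k\<close>. The prefix is then one of \<open>2 ^ k\<close> increasing words over
  \<open>T\<close>, chosen independently of the remaining word over \<open>S - T\<close>.\<close>

lemma sum_increasing_prefix:
  fixes g :: "int list \<Rightarrow> 'a :: comm_ring_1"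
  assumes fin: "finite S" and pos: "S \<subseteq> {0<..}" and k: "k \<le> card S"
  shows "(\<Sum>w \<in> signed_words S. if sorted_wrt (<) (take k w) then g (drop k w) else 0)
    = (\<Sum>T | T \<subseteq> S \<and> card T = k. 2 ^ k * (\<Sum>v \<in> signed_words (S - T). g v))"
proof -
  let ?Ts = "{T. T \<subseteq> S \<and> card T = k}"
  let ?I = "\<lambda>T. {u \<in> signed_words T. sorted_wrt (<) u}"
  have finT: "finite T" "T \<subseteq> {0<..}" if "T \<in> ?Ts" for T
    using that fin pos finite_subset by auto
  have "(\<Sum>w \<in> signed_words S. if sorted_wrt (<) (take k w) then g (drop k w) else 0)
    = (\<Sum>w | w \<in> signed_words S \<and> sorted_wrt (<) (take k w). g (drop k w))"
    using fin by (subst sum.inter_filter[symmetric]) (auto simp: finite_signed_words)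
  also have "\<dots> = (\<Sum>(T, u, v) \<in> (SIGMA T:?Ts. ?I T \<times> signed_words (S - T)). g v)"
  proof (rule sum.reindex_bij_witness[where i = "\<lambda>(T, u, v). u @ v"
        and j = "\<lambda>w. (abs ` set (take k w), take k w, drop k w)"], goal_cases)
    case (1 w)
    then show ?case by simp
  next
    case (2 w)
    then have len: "length w = card S" and dist: "distinct (map abs w)" and im: "abs ` set w = S"
      by (auto simp: length_signed_words signed_words_def)
    have app: "map abs w = map abs (take k w) @ map abs (drop k w)"
      by (simp flip: map_append)
    have d: "distinct (map abs (take k w))" "distinct (map abs (drop k w))"
       "abs ` set (take k w) \<inter> abs ` set (drop k w) = {}"
      using dist unfolding app distinct_append by auto
    have un: "abs ` set (take k w) \<union> abs ` set (drop k w) = S"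
      using im by (metis append_take_drop_id image_Un set_append)
    have "card (abs ` set (take k w)) = k"
      using d(1) k len by (metis distinct_card length_map length_take list.set_map min.absorb2)
    then show ?case using 2 d un by (simp add: signed_words_def) blast
  next
    case (3 b)
    obtain T u v where b: "b = (T, u, v)" by (cases b)
    with 3 have u: "u \<in> signed_words T" "card T = k" by auto
    have "length u = k" using length_signed_words[OF u(1)] u(2) by simp
    moreover have "abs ` set u = T" using u(1) by (simp add: signed_words_def)
    ultimately show ?case by (simp add: b)
  next
    case (4 b)
    obtain T u v where b: "b = (T, u, v)" by (cases b)
    with 4 have T: "T \<subseteq> S" "card T = k" and u: "u \<in> signed_words T" "sorted_wrt (<) u"
      and v: "v \<in> signed_words (S - T)" by auto
    have "length u = k" using length_signed_words[OF u(1)] T by simp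
    moreover have "u @ v \<in> signed_words S"
      using u(1) v T(1) by (auto simp: signed_words_def image_Un)
    ultimately show ?case using u(2) by (simp add: b)
  next
    case (5 w)
    then show ?case by simp
  qed
  also have "\<dots> = (\<Sum>T \<in> ?Ts. \<Sum>(u, v) \<in> ?I T \<times> signed_words (S - T). g v)"
  proof (rule sum.Sigma[symmetric])
    show "finite ?Ts" using fin by simp
    show "\<forall>T \<in> ?Ts. finite (?I T \<times> signed_words (S - T))"
    proof
      fix T assume T: "T \<in> ?Ts"
      have "finite (signed_words T)" "finite (signed_words (S - T))"
        using finite_signed_words[OF finT(1)[OF T]] finite_signed_words[of "S - T"] fin by auto
      then show "finite (?I T \<times> signed_words (S - T))" by simp
    qed
  qed
  also have "\<dots> = (\<Sum>T \<in> ?Ts. 2 ^ k * (\<Sum>v \<in> signed_words (S - T). g v))"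
  proof (rule sum.cong[OF refl])
    \<comment> \<open>The summand ignores the prefix \<open>u\<close>, so summing over
      \<open>u\<close> only counts the increasing words.\<close>
    fix T assume T: "T \<in> ?Ts"
    have "(\<Sum>(u, v) \<in> ?I T \<times> signed_words (S - T). g v)
      = of_nat (card (?I T)) * (\<Sum>v \<in> signed_words (S - T). g v)"
      by (subst sum.cartesian_product[symmetric]) simp
    then show "(\<Sum>(u, v) \<in> ?I T \<times> signed_words (S - T). g v)
      = 2 ^ k * (\<Sum>v \<in> signed_words (S - T). g v)"
      using card_increasing_signed_words[OF finT[OF T]] T by simp
  qed
  finally show ?thesis .
qed

text \<open>The expansion of a single word is summed over all words. All lengths equal
  \<open>card S\<close>, so the block weights are constants; the fully forced term survives for
  exactly one word.\<close>

lemma total_weight_expand: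
  fixes x y :: "nat \<Rightarrow> 'a :: comm_ring_1"
  assumes fin: "finite S" and pos: "S \<subseteq> {0<..}"
  shows "total_weight x y S =
    (\<Sum>k = 1..card S. \<Sum>T | T \<subseteq> S \<and> card T = k.
       2 ^ k * ((\<Prod>i \<in> {card S - k<..<card S}. y i - x i) * x (card S - k) * total_weight x y (S - T)))
    + (\<Prod>i<card S. y i - x i)"
proof -
  let ?n = "card S" and ?d = "\<lambda>i. y i - x i"
  let ?c = "\<lambda>k. (\<Prod>i \<in> {?n - k<..<?n}. ?d i) * x (?n - k)"
  have "total_weight x y S = (\<Sum>w \<in> signed_words S.
      (\<Sum>k = 1..?n. if sorted_wrt (<) (take k w) then ?c k * word_weight x y (drop k w) else 0)
    + (if sorted_wrt (<) (w @ [0]) then \<Prod>i<?n. ?d i else 0))"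
    unfolding total_weight_def
    by (rule sum.cong[OF refl], subst word_weight_expand) (simp only: length_signed_words)
  also have "\<dots> = (\<Sum>k = 1..?n. \<Sum>w \<in> signed_words S.
        if sorted_wrt (<) (take k w) then ?c k * word_weight x y (drop k w) else 0)
    + (\<Sum>w \<in> signed_words S. if sorted_wrt (<) (w @ [0]) then \<Prod>i<?n. ?d i else 0)"
    unfolding sum.distrib by (subst sum.swap) (rule refl)
  also have "(\<Sum>w \<in> signed_words S. if sorted_wrt (<) (w @ [0]) then \<Prod>i<?n. ?d i else 0)
    = (\<Sum>w \<in> {w \<in> signed_words S. sorted_wrt (<) (w @ [0])}. \<Prod>i<?n. ?d i)"
    using fin by (subst sum.inter_filter[symmetric]) (auto simp: finite_signed_words)
  also have "\<dots> = (\<Prod>i<?n. ?d i)"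
    unfolding increasing_negative_signed_words[OF fin pos] by simp
  also have "(\<Sum>k = 1..?n. \<Sum>w \<in> signed_words S.
        if sorted_wrt (<) (take k w) then ?c k * word_weight x y (drop k w) else 0)
    = (\<Sum>k = 1..?n. \<Sum>T | T \<subseteq> S \<and> card T = k. 2 ^ k * (?c k * total_weight x y (S - T)))"
  proof (rule sum.cong[OF refl])
    fix k assume "k \<in> {1..?n}"
    then show "(\<Sum>w \<in> signed_words S.
        if sorted_wrt (<) (take k w) then ?c k * word_weight x y (drop k w) else 0)
      = (\<Sum>T | T \<subseteq> S \<and> card T = k. 2 ^ k * (?c k * total_weight x y (S - T)))"
      using sum_increasing_prefix[OF fin pos, of k "\<lambda>v. ?c k * word_weight x y v"]
      by (simp add: total_weight_def sum_distrib_left)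
  qed
  finally show ?thesis .
qed

text \<open>The expansion itself shows this by induction, so words need not be standardised.\<close>

lemma total_weight_cong_card:
  assumes "finite S" "S \<subseteq> {0<..}" "finite S'" "S' \<subseteq> {0<..}" "card S = card S'"
  shows "total_weight x y S = total_weight x y S'"
  using assms
proof (induction "card S" arbitrary: S S' rule: less_induct)
  case less
  let ?n = "card S"
  let ?p = "\<lambda>m. total_weight x y {1..int m}"
  have *: "(\<Sum>T | T \<subseteq> R \<and> card T = k. c * (b * total_weight x y (R - T)))
        = of_nat (?n choose k) * (c * (b * ?p (?n - k)))"
    if "finite R" "R \<subseteq> {0<..}" "card R = ?n" "k \<in> {1..?n}" for R k b c
  proof -
    \<comment> \<open>Blocks are nonempty, so \<open>R - T\<close> is smaller than \<open>R\<close>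
      and can be replaced by the representative \<open>{1..int (?n - k)}\<close>.\<close>
    have "total_weight x y (R - T) = ?p (?n - k)" if "T \<subseteq> R" "card T = k" for T
    proof (rule less.hyps)
      have "finite T" using that \<open>finite R\<close> finite_subset by auto
      then have "card (R - T) = ?n - k" using that \<open>card R = ?n\<close> by (simp add: card_Diff_subset)
      then show "card (R - T) < ?n" "card (R - T) = card {1..int (?n - k)}"
        using \<open>k \<in> {1..?n}\<close> by auto
    qed (use \<open>finite R\<close> \<open>R \<subseteq> {0<..}\<close> in auto)
    then have "(\<Sum>T | T \<subseteq> R \<and> card T = k. c * (b * total_weight x y (R - T)))
      = (\<Sum>T | T \<subseteq> R \<and> card T = k. c * (b * ?p (?n - k)))"
      by (intro sum.cong) auto
    then show ?thesis using n_subsets[OF \<open>finite R\<close>, of k] that by simp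
  qed
  show ?case
    unfolding total_weight_expand[OF less.prems(1,2)] total_weight_expand[OF less.prems(3,4)]
    using less.prems by (simp add: *)
qed

text \<open>All \<open>n choose k\<close> sets \<open>T\<close> leave the same remaining weight,
  since that weight depends only on the cardinality.\<close>

lemma total_weight_recurrence:
  fixes x y :: "nat \<Rightarrow> 'a :: comm_ring_1"
  defines "p \<equiv> \<lambda>m. total_weight x y {1..int m}"
  shows "p n = (\<Sum>k = 1..n. of_nat (n choose k) * 2 ^ k
       * (\<Prod>i \<in> {n - k<..<n}. y i - x i) * x (n - k) * p (n - k)) + (\<Prod>i<n. y i - x i)"
proof -
  let ?S = "{1..int n}"
  have "(\<Sum>T | T \<subseteq> ?S \<and> card T = k. c * (b * total_weight x y (?S - T)))
        = of_nat (n choose k) * c * b * p (n - k)" for k c b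
  proof -
    have "total_weight x y (?S - T) = p (n - k)" if "T \<subseteq> ?S" "card T = k" for T
      unfolding p_def
    proof (rule total_weight_cong_card)
      have "finite T" using that finite_subset by auto
      then show "card (?S - T) = card {1..int (n - k)}" using that by (simp add: card_Diff_subset)
    qed auto
    then have "(\<Sum>T | T \<subseteq> ?S \<and> card T = k. c * (b * total_weight x y (?S - T)))
      = (\<Sum>T | T \<subseteq> ?S \<and> card T = k. c * (b * p (n - k)))"
      by (intro sum.cong) auto
    then show ?thesis using n_subsets[of ?S k] by (simp add: mult.assoc)
  qed
  note block = this
  have "?S \<subseteq> {0<..}" by auto
  then show ?thesis
    using total_weight_expand[of ?S x y] unfolding block by (simp add: p_def mult.assoc)
qed

section \<open>Signed permutations as words\<close>

text \<open>Only the values at \<open>1, ..., n\<close> are listed: the value at 0 is the appended 0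
  of \<open>word_weight\<close>, and the values at negative arguments follow by oddness.\<close>

definition perm_word :: "nat \<Rightarrow> (int \<Rightarrow> int) \<Rightarrow> int list" where
  "perm_word n \<sigma> = rev (map (\<lambda>i. \<sigma> (int (Suc i))) [0..<n])"

lemma word_weight_perm_word:
  assumes "\<sigma> 0 = 0"
  shows "word_weight x y (perm_word n \<sigma>)
    = (\<Prod>i<n. if \<sigma> (int (Suc i)) < \<sigma> (int i) then y i else x i)"
proof (induction n)
  case 0
  then show ?case by (simp add: perm_word_def)
next
  case (Suc n)
  have "perm_word (Suc n) \<sigma> = \<sigma> (int (Suc n)) # perm_word n \<sigma>"
    by (simp add: perm_word_def)
  moreover have "hd (perm_word n \<sigma> @ [0]) = \<sigma> (int n)"
    using assms by (cases n) (simp_all add: perm_word_def)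
  moreover have "length (perm_word n \<sigma>) = n" by (simp add: perm_word_def)
  ultimately show ?case using Suc by (simp add: mult.commute)
qed

text \<open>Outside the permuted set \<open>\<sigma>\<close> is the identity, which is odd as well,
  so no range condition on \<open>i\<close> remains.\<close>

lemma signed_perms_odd:
  assumes "\<sigma> \<in> signed_perms n"
  shows "\<sigma> (- i) = - \<sigma> i"
proof (cases "i \<in> {- int n..int n} - {0}")
  case True
  then show ?thesis using assms by (auto simp: signed_perms_def)
next
  case False
  then have "- i \<notin> {- int n..int n} - {0}" by auto
  with False show ?thesis using assms by (auto simp: signed_perms_def permutes_not_in)
qed

lemma perm_word_in_signed_words:
  assumes \<sigma>: "\<sigma> \<in> signed_perms n"
  shows "perm_word n \<sigma> \<in> signed_words {1..int n}"
proof -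
  have perm: "\<sigma> permutes ({- int n..int n} - {0})" using \<sigma> by (auto simp: signed_perms_def)
  have "inj_on (\<lambda>i. \<bar>\<sigma> (int (Suc i))\<bar>) {0..<n}"
  proof (rule inj_onI)
    fix i j assume "\<bar>\<sigma> (int (Suc i))\<bar> = \<bar>\<sigma> (int (Suc j))\<bar>"
    \<comment> \<open>Oddness moves the sign into the argument, where injectivity applies; both
      arguments are positive.\<close>
    then have "\<sigma> (int (Suc i)) = \<sigma> (int (Suc j)) \<or> \<sigma> (int (Suc i)) = \<sigma> (- int (Suc j))"
      unfolding signed_perms_odd[OF \<sigma>] by linarith
    then have "int (Suc i) = int (Suc j) \<or> int (Suc i) = - int (Suc j)"
      using permutes_inj[OF perm] by (meson injD)
    then show "i = j" by linarith
  qed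
  then have dist: "distinct (map abs (perm_word n \<sigma>))"
    by (simp add: perm_word_def distinct_map comp_def rev_map[symmetric])
  have "abs ` set (perm_word n \<sigma>) \<subseteq> {1..int n}"
  proof clarsimp
    fix a assume "a \<in> set (perm_word n \<sigma>)"
    then obtain i where "i < n" "a = \<sigma> (int (Suc i))" by (auto simp: perm_word_def)
    then have "a \<in> {- int n..int n} - {0}" using permutes_in_image[OF perm] by auto
    then show "1 \<le> \<bar>a\<bar> \<and> \<bar>a\<bar> \<le> int n" by auto
  qed
  \<comment> \<open>The absolute values are \<open>n\<close> distinct numbers in
    \<open>{1..int n}\<close>, hence all of them.\<close>
  moreover have "card (abs ` set (perm_word n \<sigma>)) = n"
    using distinct_card[OF dist] by (simp add: perm_word_def)
  ultimately have "abs ` set (perm_word n \<sigma>) = {1..int n}"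
    by (intro card_subset_eq) auto
  then show ?thesis using dist by (simp add: signed_words_def)
qed

lemma inj_on_perm_word: "inj_on (perm_word n) (signed_perms n)"
proof (rule inj_onI, rule ext)
  fix \<sigma> \<tau> i assume \<sigma>: "\<sigma> \<in> signed_perms n" and \<tau>: "\<tau> \<in> signed_perms n"
    and eq: "perm_word n \<sigma> = perm_word n \<tau>"
  have pos: "\<sigma> i = \<tau> i" if "1 \<le> i" "i \<le> int n" for i
  proof -
    have "nat (i - 1) < n" using that by auto
    then have "\<sigma> (int (Suc (nat (i - 1)))) = \<tau> (int (Suc (nat (i - 1))))"
      using eq unfolding perm_word_def rev_is_rev_conv map_eq_conv
      by (metis atLeast0LessThan lessThan_iff set_upt)
    then show ?thesis using that by simp
  qed
  consider "i \<notin> {- int n..int n} - {0}" | "1 \<le> i" "i \<le> int n" | "1 \<le> - i" "- i \<le> int n"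
    by fastforce
  then show "\<sigma> i = \<tau> i"
  proof cases
    case 1
    then show ?thesis using \<sigma> \<tau> by (auto simp: signed_perms_def permutes_not_in)
  next
    case 2
    then show ?thesis by (rule pos)
  next
    case 3
    then have "\<sigma> (- i) = \<tau> (- i)" by (rule pos)
    then show ?thesis by (simp add: signed_perms_odd[OF \<sigma>] signed_perms_odd[OF \<tau>])
  qed
qed

lemma signed_words_subset_perm_word: "signed_words {1..int n} \<subseteq> perm_word n ` signed_perms n"
proof
  fix w assume w: "w \<in> signed_words {1..int n}"
  then have len: "length w = n" using length_signed_words[OF w] by simp
  have dist: "distinct (map abs w)" and im: "abs ` set w = {1..int n}"
    using w by (auto simp: signed_words_def)
  let ?A = "{- int n..int n} - {0}"
  \<comment> \<open>The word is extended oddly. Since it is stored in reverse, the value at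
    \<open>i > 0\<close> has list index \<open>n - i\<close>.\<close>
  define \<sigma> where "\<sigma> i = (if i \<in> ?A then sgn i * w ! (n - nat \<bar>i\<bar>) else i)" for i
  have w_nth: "1 \<le> \<bar>w ! (n - nat \<bar>i\<bar>)\<bar> \<and> \<bar>w ! (n - nat \<bar>i\<bar>)\<bar> \<le> int n" if "i \<in> ?A" for i
  proof -
    have "n - nat \<bar>i\<bar> < length w" using that len by auto
    then have "\<bar>w ! (n - nat \<bar>i\<bar>)\<bar> \<in> {1..int n}" unfolding im[symmetric] by auto
    then show ?thesis by simp
  qed
  have abs_\<sigma>: "\<bar>\<sigma> i\<bar> = \<bar>w ! (n - nat \<bar>i\<bar>)\<bar>" if "i \<in> ?A" for i
    using that by (simp add: \<sigma>_def abs_mult abs_sgn_eq)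
  have odd: "\<sigma> (- i) = - \<sigma> i" for i
    by (auto simp: \<sigma>_def)
  have "inj_on \<sigma> ?A"
  proof (rule inj_onI)
    fix i j assume i: "i \<in> ?A" and j: "j \<in> ?A" and eq: "\<sigma> i = \<sigma> j"
    have lt: "n - nat \<bar>i\<bar> < length w" "n - nat \<bar>j\<bar> < length w" using i j len by auto
    have "\<bar>w ! (n - nat \<bar>i\<bar>)\<bar> = \<bar>w ! (n - nat \<bar>j\<bar>)\<bar>"
      using eq abs_\<sigma>[OF i] abs_\<sigma>[OF j] by simp
    then have "map abs w ! (n - nat \<bar>i\<bar>) = map abs w ! (n - nat \<bar>j\<bar>)" using lt by simp
    then have "n - nat \<bar>i\<bar> = n - nat \<bar>j\<bar>"
      using nth_eq_iff_index_eq[OF dist] lt by simp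
    then have "\<bar>i\<bar> = \<bar>j\<bar>" using i j by auto
    \<comment> \<open>With \<open>i = - j\<close>, oddness and
      \<open>\<sigma> i = \<sigma> j\<close> would give the value 0, which is no letter of
      \<open>w\<close>.\<close>
    moreover have "i \<noteq> - j"
    proof
      assume "i = - j"
      then have "\<sigma> j = 0" using eq odd[of j] by simp
      then show False using abs_\<sigma>[OF j] w_nth[OF j] by simp
    qed
    ultimately show "i = j" by linarith
  qed
  moreover have "\<sigma> ` ?A \<subseteq> ?A"
  proof (rule image_subsetI)
    fix i assume "i \<in> ?A"
    then have "1 \<le> \<bar>\<sigma> i\<bar>" "\<bar>\<sigma> i\<bar> \<le> int n" using abs_\<sigma> w_nth by simp_all
    then show "\<sigma> i \<in> ?A" by auto
  qed
  ultimately have "bij_betw \<sigma> ?A ?A"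
    by (simp add: bij_betw_def endo_inj_surj)
  then have "\<sigma> permutes ?A" by (rule bij_imp_permutes) (auto simp: \<sigma>_def)
  then have "\<sigma> \<in> signed_perms n" using odd by (simp add: signed_perms_def)
  moreover have "perm_word n \<sigma> = w"
  proof (rule nth_equalityI)
    show "length (perm_word n \<sigma>) = length w" by (simp add: perm_word_def len)
    fix i assume "i < length (perm_word n \<sigma>)"
    then have i: "i < n" by (simp add: perm_word_def)
    then have "perm_word n \<sigma> ! i = \<sigma> (int (n - i))"
      by (simp add: perm_word_def rev_nth Suc_diff_Suc)
    also have "\<dots> = w ! i" using i by (simp add: \<sigma>_def del: of_nat_diff)
    finally show "perm_word n \<sigma> ! i = w ! i" .
  qed
  ultimately show "w \<in> perm_word n ` signed_perms n" by blast
qed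

lemma bij_betw_perm_word: "bij_betw (perm_word n) (signed_perms n) (signed_words {1..int n})"
  using inj_on_perm_word perm_word_in_signed_words signed_words_subset_perm_word
  by (fastforce simp: bij_betw_def)

lemma signed_perm_weight:
  fixes x0 x1 y0 y1 :: "'a :: comm_ring_1"
  assumes \<sigma>: "\<sigma> \<in> signed_perms n"
  shows "x0 ^ asc0 n \<sigma> * x1 ^ asc1 n \<sigma> * y0 ^ des0 n \<sigma> * y1 ^ des1 n \<sigma> =
    word_weight (\<lambda>i. if even i then x0 else x1) (\<lambda>i. if even i then y0 else y1) (perm_word n \<sigma>)"
proof -
  have perm: "\<sigma> permutes ({- int n..int n} - {0})" using \<sigma> by (auto simp: signed_perms_def)
  \<comment> \<open>Injectivity excludes ties between neighbouring values, so ascents and descents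
    are complementary.\<close>
  have "is_ascent \<sigma> i \<longleftrightarrow> \<not> is_descent \<sigma> i" for i
  proof -
    have "\<sigma> (int i) \<noteq> \<sigma> (int (i + 1))" unfolding inj_eq[OF permutes_inj[OF perm]] by simp
    then show ?thesis by (auto simp: is_ascent_def is_descent_def)
  qed
  then have asc: "is_ascent \<sigma> = (\<lambda>i. \<not> is_descent \<sigma> i)" by blast
  \<comment> \<open>Each power becomes a product over all positions, so that the four statistics can
    be merged position by position.\<close>
  have pow: "c ^ card {i \<in> {0..<n}. P i} = (\<Prod>i<n. if P i then c else 1)" for c :: 'a and P
    unfolding prod.inter_filter[symmetric, OF finite_lessThan]
    by (simp add: atLeast0LessThan)
  have "\<sigma> 0 = 0" using perm by (simp add: permutes_not_in)
  then show ?thesis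
    unfolding word_weight_perm_word[of \<sigma>, OF \<open>\<sigma> 0 = 0\<close>] asc0_def asc1_def des0_def des1_def pow asc
      prod.distrib[symmetric]
    by (intro prod.cong) (auto simp: is_descent_def)
qed

lemma PB_eq_total_weight:
  fixes x0 x1 y0 y1 :: "'a :: comm_ring_1"
  shows "PB n x0 x1 y0 y1 =
    total_weight (\<lambda>i. if even i then x0 else x1) (\<lambda>i. if even i then y0 else y1) {1..int n}"
  unfolding PB_def total_weight_def
  by (rule sum.reindex_bij_betw[OF bij_betw_perm_word, THEN subst]) (simp add: signed_perm_weight)

section \<open>Hyperbolic series\<close>

text \<open>
  These are \<open>cosh (c \<surd>\<alpha> t)\<close> and \<open>sinh (c \<surd>\<alpha> t) / \<surd>\<alpha>\<close>, which make sense without a square root of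
  \<open>\<alpha>\<close> in the field.
\<close>

definition fps_cosh :: "'a \<Rightarrow> 'a \<Rightarrow> 'a :: field_char_0 fps" where
  "fps_cosh \<alpha> c = even_series (\<lambda>m. \<alpha> ^ (m div 2) * c ^ m / fact m)"

definition fps_sinh :: "'a \<Rightarrow> 'a \<Rightarrow> 'a :: field_char_0 fps" where
  "fps_sinh \<alpha> c = odd_series (\<lambda>m. \<alpha> ^ (m div 2) * c ^ m / fact m)"

lemma fps_deriv_cosh: "fps_deriv (fps_cosh \<alpha> c) = fps_const (\<alpha> * c) * fps_sinh \<alpha> c"
proof (rule fps_ext)
  fix n
  have "of_nat (Suc n) * (z / fact (Suc n)) = z / fact n" for z :: 'a
    by (simp add: field_simps del: of_nat_Suc)
  then show "fps_deriv (fps_cosh \<alpha> c) $ n = (fps_const (\<alpha> * c) * fps_sinh \<alpha> c) $ n"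
    by (auto simp: fps_cosh_def fps_sinh_def even_series_def odd_series_def elim!: oddE
        simp del: of_nat_Suc fact_Suc)
qed

lemma fps_deriv_sinh: "fps_deriv (fps_sinh \<alpha> c) = fps_const c * fps_cosh \<alpha> c"
proof (rule fps_ext)
  fix n
  have "of_nat (Suc n) * (z / fact (Suc n)) = z / fact n" for z :: 'a
    by (simp add: field_simps del: of_nat_Suc)
  then show "fps_deriv (fps_sinh \<alpha> c) $ n = (fps_const c * fps_cosh \<alpha> c) $ n"
    by (auto simp: fps_cosh_def fps_sinh_def even_series_def odd_series_def elim!: evenE
        simp del: of_nat_Suc fact_Suc)
qed

lemma fps_cosh_0 [simp]: "fps_cosh \<alpha> c $ 0 = 1" and fps_sinh_0 [simp]: "fps_sinh \<alpha> c $ 0 = 0"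
  by (simp_all add: fps_cosh_def fps_sinh_def even_series_def odd_series_def)

lemma fps_const_eqI:
  fixes f :: "'a :: field_char_0 fps"
  assumes "fps_deriv f = 0"
  shows "f = fps_const (f $ 0)"
  using assms fps_deriv_eq_0_iff by blast

text \<open>The left side has derivative 0 and constant term 1.\<close>

lemma fps_cosh_sinh_squares:
  fixes \<alpha> c :: "'a :: field_char_0"
  shows "fps_cosh \<alpha> c * fps_cosh \<alpha> c - fps_const \<alpha> * (fps_sinh \<alpha> c * fps_sinh \<alpha> c) = 1"
    (is "?f = _")
proof -
  have "fps_deriv ?f = 0"
    by (simp add: fps_deriv_cosh fps_deriv_sinh fps_const_mult[symmetric] algebra_simps
        del: fps_const_mult)
  from fps_const_eqI[OF this] show ?thesis by simp
qed

text \<open>These are the subtraction formulas for arguments 2 and 1. The left sides satisfy the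
  same linear differential system as \<open>C1\<close> and \<open>S1\<close>, with the same initial
  values, so uniqueness gives equality.\<close>

lemma fps_cosh_sinh_diff:
  fixes \<alpha> :: "'a :: field_char_0"
  defines "C1 \<equiv> fps_cosh \<alpha> 1" and "S1 \<equiv> fps_sinh \<alpha> 1"
    and "C2 \<equiv> fps_cosh \<alpha> 2" and "S2 \<equiv> fps_sinh \<alpha> 2" and "A \<equiv> fps_const \<alpha>"
  shows "C1 * C2 - A * (S1 * S2) = C1" and "S2 * C1 - C2 * S1 = S1"
proof -
  let ?U = "C1 * C2 - A * (S1 * S2)" and ?V = "S2 * C1 - C2 * S1"
  have two: "fps_const (2 :: 'a) = 2" by (simp add: numeral_fps_const)
  have dC1: "fps_deriv C1 = A * S1" and dS1: "fps_deriv S1 = C1"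
    and dC2: "fps_deriv C2 = 2 * (A * S2)" and dS2: "fps_deriv S2 = 2 * C2" and dA: "fps_deriv A = 0"
    by (simp_all add: assms fps_deriv_cosh fps_deriv_sinh fps_const_mult[symmetric] two mult_ac
        del: fps_const_mult)
  have U: "fps_deriv ?U = A * ?V" and V: "fps_deriv ?V = ?U"
    by (simp_all add: dC1 dS1 dC2 dS2 dA algebra_simps)
  have U0: "?U $ 0 = 1" and V0: "?V $ 0 = 0" by (simp_all add: assms)
  have cst: "f = fps_const (f $ 0)" if "fps_deriv f = 0" for f :: "'a fps"
    using that by (rule fps_const_eqI)
  define u v where "u = ?U" and "v = ?V"
  have du: "fps_deriv u = A * v" and dv: "fps_deriv v = u" and u0: "u $ 0 = 1" and v0: "v $ 0 = 0"
    using U V U0 V0 by (simp_all only: u_def v_def)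
  \<comment> \<open>This combination and the next have derivative 0 and are therefore equal to their
    constant terms 1 and 0.\<close>
  have "fps_deriv (u * C1 - A * (v * S1)) = 0"
    by (simp add: du dv dC1 dS1 dA algebra_simps)
  from cst[OF this] have 1: "u * C1 - A * (v * S1) = 1"
    by (simp add: u0 v0 assms)
  have "fps_deriv (v * C1 - u * S1) = 0"
    by (simp add: du dv dC1 dS1 dA algebra_simps)
  from cst[OF this] have 2: "v * C1 - u * S1 = 0"
    by (simp add: u0 v0 assms)
  have 3: "C1 * C1 - A * (S1 * S1) = 1" unfolding assms by (rule fps_cosh_sinh_squares)
  \<comment> \<open>Equations \<open>1\<close> and \<open>2\<close> are linear in \<open>u\<close>
    and \<open>v\<close> with determinant 1 by \<open>3\<close>; they are solved by
    elimination.\<close>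
  have "u * (C1 * C1 - A * (S1 * S1)) = (u * C1 - A * (v * S1)) * C1 + A * S1 * (v * C1 - u * S1)"
    by (simp add: algebra_simps)
  then show "?U = C1" by (simp add: 1 2 3 flip: u_def)
  have "v * (C1 * C1 - A * (S1 * S1)) = (u * C1 - A * (v * S1)) * S1 + C1 * (v * C1 - u * S1)"
    by (simp add: algebra_simps)
  then show "?V = S1" by (simp add: 1 2 3 flip: v_def)
qed

section \<open>The generating functions\<close>

lemma prod_alternating_lessThan:
  fixes d0 d1 :: "'a :: comm_ring_1"
  shows "(\<Prod>i<n. if even i then d0 else d1) = (d0 * d1) ^ (n div 2) * (if even n then 1 else d0)"
  by (induction n) (auto simp: mult_ac elim!: evenE oddE)

text \<open>The \<open>m\<close> consecutive positions pair up into factors \<open>d0 * d1\<close>;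
  for odd \<open>m\<close> the leftover factor has the parity of \<open>j + 1\<close>.\<close>

lemma prod_alternating_interval:
  fixes d0 d1 :: "'a :: comm_ring_1"
  shows "(\<Prod>i \<in> {j<..<j + Suc m}. if even i then d0 else d1)
    = (d0 * d1) ^ (m div 2) * (if even m then 1 else if even j then d1 else d0)"
proof (induction m)
  case 0
  have "{j<..<j + Suc 0} = {}" by auto
  then show ?case by simp
next
  case (Suc m)
  have "{j<..<j + Suc (Suc m)} = insert (j + Suc m) {j<..<j + Suc m}" by auto
  then have "(\<Prod>i \<in> {j<..<j + Suc (Suc m)}. if even i then d0 else d1)
    = (if even (j + Suc m) then d0 else d1) * (\<Prod>i \<in> {j<..<j + Suc m}. if even i then d0 else d1)"
    by simp
  then show ?case unfolding Suc by (auto simp: mult_ac elim!: evenE oddE)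
qed

text \<open>Cramer's rule for the even part \<open>E\<close> and the odd part \<open>O'\<close>.
  Here \<open>H\<close> is the series of even blocks, and \<open>C1\<close>, \<open>S1\<close>,
  \<open>C2\<close>, \<open>S2\<close> are the hyperbolic series with arguments 1 and 2.\<close>

lemma solve_linear_system:
  fixes E :: "'a :: comm_ring_1"
  assumes E: "E = (y1 - x1) * x0 * (H * E) + x1 * (S2 * O') + C1"
    and O: "O' = x0 * (S2 * E) + (y0 - x0) * x1 * (H * O') + (y0 - x0) * S1"
    and H: "(y0 - x0) * (y1 - x1) * H = C2 - 1"
    and sq: "C2 * C2 - (y0 - x0) * (y1 - x1) * (S2 * S2) = 1"
    and C: "C1 * C2 - (y0 - x0) * (y1 - x1) * (S1 * S2) = C1"
    and S: "S2 * C1 - C2 * S1 = S1"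
  shows "E * (x0 * x1 + y0 * y1 - (x0 * y1 + x1 * y0) * C2) = (y0 - x0) * (y1 - x1) * C1"
    and "O' * (x0 * x1 + y0 * y1 - (x0 * y1 + x1 * y0) * C2)
      = (y0 - x0) * (y1 - x1) * ((x0 + y0) * S1)"
proof -
  define d0 d1 where "d0 = y0 - x0" and "d1 = y1 - x1"
  \<comment> \<open>Multiplying by \<open>d0\<close> (and the other equation by \<open>d1\<close>)
    turns the coefficient of \<open>H\<close> into \<open>d0 * d1 * H = C2 - 1\<close>, which
    eliminates \<open>H\<close>.\<close>
  have "d0 * E = x0 * ((d0 * d1 * H) * E) + d0 * (x1 * (S2 * O') + C1)"
    by (subst E) (simp add: d0_def d1_def algebra_simps)
  then have 1: "(y0 - x0 * C2) * E - d0 * x1 * (S2 * O') = d0 * C1"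
    unfolding d0_def d1_def H by (simp add: algebra_simps)
  have "d1 * O' = x1 * ((d0 * d1 * H) * O') + d1 * (x0 * (S2 * E)) + d0 * d1 * S1"
    by (subst O) (simp add: d0_def d1_def algebra_simps)
  then have 2: "(y1 - x1 * C2) * O' - d1 * x0 * (S2 * E) = d0 * d1 * S1"
    unfolding d0_def d1_def H by (simp add: algebra_simps)
  \<comment> \<open>The stated denominator is the determinant of the system formed by
    \<open>1\<close> and \<open>2\<close>, by the identity for squares.\<close>
  have det: "x0 * x1 + y0 * y1 - (x0 * y1 + x1 * y0) * C2
    = (y0 - x0 * C2) * (y1 - x1 * C2) - x0 * x1 * (d0 * d1 * (S2 * S2))"
  proof -
    have "d0 * d1 * (S2 * S2) = C2 * C2 - 1" using sq by (simp add: d0_def d1_def algebra_simps)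
    then show ?thesis by (simp only:) (simp add: algebra_simps)
  qed
  \<comment> \<open>Weighting \<open>1\<close> and \<open>2\<close> by cofactors cancels
    \<open>O'\<close>; the subtraction formula \<open>C\<close> then simplifies the right
    side.\<close>
  have "E * (x0 * x1 + y0 * y1 - (x0 * y1 + x1 * y0) * C2)
    = ((y0 - x0 * C2) * E - d0 * x1 * (S2 * O')) * (y1 - x1 * C2)
      + d0 * x1 * S2 * ((y1 - x1 * C2) * O' - d1 * x0 * (S2 * E))"
    unfolding det by (simp add: algebra_simps)
  also have "\<dots> = d0 * (y1 * C1 - x1 * (C1 * C2 - d0 * d1 * (S1 * S2)))"
    unfolding 1 2 by (simp add: algebra_simps)
  also have "\<dots> = d0 * d1 * C1"
    using C by (simp add: d0_def d1_def) (simp add: algebra_simps)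
  finally show "E * (x0 * x1 + y0 * y1 - (x0 * y1 + x1 * y0) * C2) = (y0 - x0) * (y1 - x1) * C1"
    by (simp add: d0_def d1_def)
  have "O' * (x0 * x1 + y0 * y1 - (x0 * y1 + x1 * y0) * C2)
    = ((y1 - x1 * C2) * O' - d1 * x0 * (S2 * E)) * (y0 - x0 * C2)
      + d1 * x0 * S2 * ((y0 - x0 * C2) * E - d0 * x1 * (S2 * O'))"
    unfolding det by (simp add: algebra_simps)
  also have "\<dots> = d0 * d1 * (y0 * S1 + x0 * (S2 * C1 - C2 * S1))"
    unfolding 1 2 by (simp add: algebra_simps)
  also have "\<dots> = d0 * d1 * ((x0 + y0) * S1)"
    unfolding S by (simp add: algebra_simps)
  finally show "O' * (x0 * x1 + y0 * y1 - (x0 * y1 + x1 * y0) * C2)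
      = (y0 - x0) * (y1 - x1) * ((x0 + y0) * S1)"
    by (simp add: d0_def d1_def)
qed

section \<open>The linear system for the even and odd generating functions\<close>

context
  fixes x0 x1 y0 y1 :: "'a :: field_char_0"
begin

text \<open>This is \<open>(fps_cosh \<alpha> 2 - 1) / \<alpha>\<close> with
  \<open>\<alpha> = (y0 - x0) * (y1 - x1)\<close>, written without division. It enumerates the
  nonempty blocks of even length, up to the one unpaired forced factor;
  \<open>fps_sinh \<alpha> 2\<close> does so for odd length.\<close>

definition block_series :: "'a fps" where
  "block_series = even_series (\<lambda>k. if k = 0 then 0
     else ((y0 - x0) * (y1 - x1)) ^ (k div 2 - 1) * 2 ^ k / fact k)"

definition PB_even :: "'a fps" where
  "PB_even = even_series (\<lambda>m. PB m x0 x1 y0 y1 / fact m)"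

definition PB_odd :: "'a fps" where
  "PB_odd = odd_series (\<lambda>m. PB m x0 x1 y0 y1 / fact m)"

lemma block_series_cosh:
  "fps_const ((y0 - x0) * (y1 - x1)) * block_series = fps_cosh ((y0 - x0) * (y1 - x1)) 2 - 1"
proof (rule fps_ext)
  fix n
  have "c * c ^ (b - Suc 0) = c ^ b" if "0 < b" for c :: 'a and b
    using that by (cases b) auto
  then show "(fps_const ((y0 - x0) * (y1 - x1)) * block_series) $ n
    = (fps_cosh ((y0 - x0) * (y1 - x1)) 2 - 1) $ n"
    by (cases "n = 0") (auto simp: block_series_def fps_cosh_def even_series_def elim!: evenE
        simp flip: mult.assoc)
qed

text \<open>Division by \<open>fact n\<close> turns the binomial coefficient into the form of a
  Cauchy product. A block of length \<open>k\<close> has only \<open>k - 1\<close> forced positions,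
  which explains the exponent.\<close>

lemma PB_recurrence:
  "PB n x0 x1 y0 y1 / fact n =
    (\<Sum>k = 1..n. 2 ^ k / fact k
       * (((y0 - x0) * (y1 - x1)) ^ ((k - 1) div 2)
           * (if odd k then 1 else if even (n - k) then y1 - x1 else y0 - x0))
       * (if even (n - k) then x0 else x1) * (PB (n - k) x0 x1 y0 y1 / fact (n - k)))
    + ((y0 - x0) * (y1 - x1)) ^ (n div 2) * (if even n then 1 else y0 - x0) / fact n"
proof -
  let ?x = "\<lambda>i. if even i then x0 else x1" and ?y = "\<lambda>i. if even i then y0 else y1"
  have d: "?y i - ?x i = (if even i then y0 - x0 else y1 - x1)" for i :: nat by simp
  have block: "(\<Prod>i \<in> {n - k<..<n}. ?y i - ?x i) = ((y0 - x0) * (y1 - x1)) ^ ((k - 1) div 2)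
           * (if odd k then 1 else if even (n - k) then y1 - x1 else y0 - x0)"
    if "k \<in> {1..n}" for k
  proof -
    have "n = (n - k) + Suc (k - 1)" using that by auto
    then have "{n - k<..<n} = {n - k<..<(n - k) + Suc (k - 1)}" by simp
    then show ?thesis
      unfolding d using prod_alternating_interval[of "y0 - x0" "y1 - x1" "n - k" "k - 1"] that by simp
  qed
  have "PB n x0 x1 y0 y1 = (\<Sum>k = 1..n. of_nat (n choose k) * 2 ^ k
       * (\<Prod>i \<in> {n - k<..<n}. ?y i - ?x i) * ?x (n - k) * PB (n - k) x0 x1 y0 y1)
       + (\<Prod>i<n. ?y i - ?x i)"
    unfolding PB_eq_total_weight by (rule total_weight_recurrence)
  then show ?thesis
    unfolding d prod_alternating_lessThan
    by (simp only: add_divide_distrib sum_divide_distrib d[symmetric])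
      (intro arg_cong2[of _ _ _ _ "(+)"] sum.cong refl,
        auto simp: block binomial_fact field_simps)
qed

text \<open>For even \<open>n\<close> an even block leaves an even rest, with free weight
  \<open>x0\<close> and an unpaired forced factor at an odd position; an odd block leaves an odd
  rest with free weight \<open>x1\<close>. The fully forced words give the last term.\<close>

lemma PB_even_eq:
  "PB_even = fps_const (y1 - x1) * fps_const x0 * (block_series * PB_even)
    + fps_const x1 * (fps_sinh ((y0 - x0) * (y1 - x1)) 2 * PB_odd)
    + fps_cosh ((y0 - x0) * (y1 - x1)) 1"
proof (rule fps_ext)
  fix n
  let ?\<alpha> = "(y0 - x0) * (y1 - x1)"
  let ?s = "\<lambda>k. (y1 - x1) * x0 * (block_series $ k * PB_even $ (n - k))
    + x1 * (fps_sinh ?\<alpha> 2 $ k * PB_odd $ (n - k))"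
  have "?s k = (if even n then 2 ^ k / fact k
       * (?\<alpha> ^ ((k - 1) div 2) * (if odd k then 1 else if even (n - k) then y1 - x1 else y0 - x0))
       * (if even (n - k) then x0 else x1) * (PB (n - k) x0 x1 y0 y1 / fact (n - k)) else 0)"
    if "k \<in> {1..n}" for k
  proof (cases "even k")
    case True
    \<comment> \<open>Since \<open>k > 0\<close>, it has the form \<open>2 * Suc m\<close>, for
      which \<open>(k - 1) div 2\<close> and \<open>k div 2 - 1\<close> agree.\<close>
    then obtain m where "k = 2 * m" by (elim evenE)
    with that have "k = 2 * Suc (m - 1)" by auto
    then obtain m where "k = 2 * Suc m" by blast
    then show ?thesis using that
      by (auto simp: block_series_def PB_even_def PB_odd_def fps_sinh_def even_series_def odd_series_def
        mult_ac)
  next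
    case False
    then show ?thesis using that
      by (auto simp: block_series_def PB_even_def PB_odd_def fps_sinh_def even_series_def odd_series_def
        mult_ac elim!: oddE)
  qed
  then have "(\<Sum>k = 1..n. ?s k) + fps_cosh ?\<alpha> 1 $ n = PB_even $ n"
    by (simp add: PB_even_def fps_cosh_def even_series_def PB_recurrence[of n])
  \<comment> \<open>Both block series have constant term 0, so the Cauchy product has no
    contribution from \<open>k = 0\<close>.\<close>
  moreover have "(\<Sum>k = 0..n. ?s k) = (\<Sum>k = 1..n. ?s k)"
    by (simp add: sum.atLeast_Suc_atMost block_series_def even_series_def)
  ultimately show "PB_even $ n = (fps_const (y1 - x1) * fps_const x0 * (block_series * PB_even)
    + fps_const x1 * (fps_sinh ?\<alpha> 2 * PB_odd) + fps_cosh ?\<alpha> 1) $ n"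
    by (simp add: fps_mult_nth[of block_series] fps_mult_nth[of "fps_sinh ?\<alpha> 2"]
        sum.distrib sum_distrib_left mult.assoc)
qed

text \<open>For odd \<open>n\<close> the parities of the rest are exchanged. The unpaired forced
  factor of an even block, and that of a fully forced word, now sits at an even position and equals
  \<open>y0 - x0\<close>.\<close>

lemma PB_odd_eq:
  "PB_odd = fps_const x0 * (fps_sinh ((y0 - x0) * (y1 - x1)) 2 * PB_even)
    + fps_const (y0 - x0) * fps_const x1 * (block_series * PB_odd)
    + fps_const (y0 - x0) * fps_sinh ((y0 - x0) * (y1 - x1)) 1"
proof (rule fps_ext)
  fix n
  let ?\<alpha> = "(y0 - x0) * (y1 - x1)"
  let ?s = "\<lambda>k. x0 * (fps_sinh ?\<alpha> 2 $ k * PB_even $ (n - k))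
    + (y0 - x0) * x1 * (block_series $ k * PB_odd $ (n - k))"
  have "?s k = (if odd n then 2 ^ k / fact k
       * (?\<alpha> ^ ((k - 1) div 2) * (if odd k then 1 else if even (n - k) then y1 - x1 else y0 - x0))
       * (if even (n - k) then x0 else x1) * (PB (n - k) x0 x1 y0 y1 / fact (n - k)) else 0)"
    if "k \<in> {1..n}" for k
  proof (cases "even k")
    case True
    then obtain m where "k = 2 * m" by (elim evenE)
    with that have "k = 2 * Suc (m - 1)" by auto
    then obtain m where "k = 2 * Suc m" by blast
    then show ?thesis using that
      by (auto simp: block_series_def PB_even_def PB_odd_def fps_sinh_def even_series_def odd_series_def
        mult_ac)
  next
    case False
    then show ?thesis using that
      by (auto simp: block_series_def PB_even_def PB_odd_def fps_sinh_def even_series_def odd_series_def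
        mult_ac elim!: oddE)
  qed
  then have "(\<Sum>k = 1..n. ?s k) + (y0 - x0) * fps_sinh ?\<alpha> 1 $ n = PB_odd $ n"
    by (simp add: PB_odd_def fps_sinh_def odd_series_def PB_recurrence[of n])
  moreover have "(\<Sum>k = 0..n. ?s k) = (\<Sum>k = 1..n. ?s k)"
    by (simp add: sum.atLeast_Suc_atMost block_series_def even_series_def)
  ultimately show "PB_odd $ n = (fps_const x0 * (fps_sinh ?\<alpha> 2 * PB_even)
    + fps_const (y0 - x0) * fps_const x1 * (block_series * PB_odd)
    + fps_const (y0 - x0) * fps_sinh ?\<alpha> 1) $ n"
    by (simp add: fps_mult_nth[of block_series] fps_mult_nth[of "fps_sinh ?\<alpha> 2"]
        sum.distrib sum_distrib_left mult.assoc)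
qed

end

theorem theorem1p4:
  fixes x0 x1 y0 y1 \<alpha> :: "'a :: field_char_0"
  assumes "\<alpha> = (y0 - x0) * (y1 - x1)"
    and "\<alpha> \<noteq> 0"
  shows "(even_series (\<lambda>m. if m \<ge> 1 then PB m x0 x1 y0 y1 / fact m else 0) =
      (fps_const (x0 * y1 + x1 * y0) * even_series (\<lambda>m. \<alpha> ^ (m div 2) * 2 ^ m / fact m)
        + even_series (\<lambda>m. \<alpha> ^ (m div 2 + 1) / fact m)
        - fps_const (x1 * x0 + y0 * y1)) /
      (fps_const (x0 * x1 + y0 * y1)
        - fps_const (y1 * x0 + x1 * y0) * even_series (\<lambda>m. \<alpha> ^ (m div 2) * 2 ^ m / fact m))) \<and>
    (odd_series (\<lambda>m. PB m x0 x1 y0 y1 / fact m) =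
      (fps_const ((y0\<^sup>2 - x0\<^sup>2) * (y1 - x1)) * odd_series (\<lambda>m. \<alpha> ^ (m div 2) / fact m)) /
      (fps_const (x0 * x1 + y0 * y1)
        - fps_const (x0 * y1 + x1 * y0) * even_series (\<lambda>m. \<alpha> ^ (m div 2) * 2 ^ m / fact m)))"
proof -
  let ?c = "fps_const :: 'a \<Rightarrow> 'a fps"
  define E F where "E = PB_even x0 x1 y0 y1" and "F = PB_odd x0 x1 y0 y1"
  define D where "D = ?c (x0 * x1 + y0 * y1) - ?c (x0 * y1 + x1 * y0) * fps_cosh \<alpha> 2"
  have c_hom: "?c (a * b) = ?c a * ?c b" "?c (a + b) = ?c a + ?c b" "?c (a - b) = ?c a - ?c b" for a b
    by simp_all
  have A: "?c \<alpha> = (?c y0 - ?c x0) * (?c y1 - ?c x1)" by (simp add: assms(1))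
  \<comment> \<open>The system is solved in the ring of power series, so the constants are split
    into \<open>fps_const\<close> of the single variables.\<close>
  note system = PB_even_eq[of x0 x1 y0 y1, folded assms(1), folded E_def F_def, unfolded c_hom]
    PB_odd_eq[of x0 x1 y0 y1, folded assms(1), folded E_def F_def, unfolded c_hom]
    block_series_cosh[of y0 x0 y1 x1, folded assms(1), unfolded A]
    fps_cosh_sinh_squares[of \<alpha> 2, unfolded A] fps_cosh_sinh_diff[of \<alpha>, unfolded A]
  have ED: "E * D = ?c \<alpha> * fps_cosh \<alpha> 1" and FD: "F * D = ?c \<alpha> * (?c (x0 + y0) * fps_sinh \<alpha> 1)"
    using solve_linear_system[OF system] unfolding D_def c_hom A by simp_all
  \<comment> \<open>The constant term of the denominator is
    \<open>x0 * x1 + y0 * y1 - x0 * y1 - x1 * y0\<close>, which factors as \<open>\<alpha>\<close>;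
    so \<open>D\<close> is nonzero and the quotients are exact.\<close>
  have "D $ 0 = \<alpha>" by (simp add: D_def assms(1) algebra_simps)
  then have D0: "D $ 0 \<noteq> 0" using assms(2) by simp
  have quotient: "G = N / D" if "G * D = N" for G N
    using that D0 by (metis fps_nonzeroI nonzero_mult_div_cancel_right)
  have PB0: "PB 0 x0 x1 y0 y1 = 1"
    using PB_recurrence[of 0 x0 x1 y0 y1] by simp
  have "even_series (\<lambda>m. if m \<ge> 1 then PB m x0 x1 y0 y1 / fact m else 0) = E - 1"
    by (rule fps_ext) (auto simp: E_def PB_even_def even_series_def PB0)
  moreover have "even_series (\<lambda>m. \<alpha> ^ (m div 2 + 1) / fact m) = ?c \<alpha> * fps_cosh \<alpha> 1"
    by (rule fps_ext) (simp add: fps_cosh_def even_series_def)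
  moreover have "odd_series (\<lambda>m. \<alpha> ^ (m div 2) / fact m) = fps_sinh \<alpha> 1"
    by (simp add: fps_sinh_def)
  \<comment> \<open>The sum starts at exponent 1, so the constant term \<open>PB 0 = 1\<close> is
    removed; this subtracts \<open>D\<close> from the numerator.\<close>
  moreover have "(E - 1) * D = ?c (x0 * y1 + x1 * y0) * fps_cosh \<alpha> 2 + ?c \<alpha> * fps_cosh \<alpha> 1
      - ?c (x1 * x0 + y0 * y1)"
    using ED by (simp add: D_def algebra_simps)
  moreover have "F * D = ?c ((y0\<^sup>2 - x0\<^sup>2) * (y1 - x1)) * fps_sinh \<alpha> 1"
  proof -
    have "\<alpha> * (x0 + y0) = (y0\<^sup>2 - x0\<^sup>2) * (y1 - x1)"
      by (simp add: assms(1) power2_eq_square algebra_simps)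
    then show ?thesis using FD by (metis c_hom(1) mult.assoc)
  qed
  ultimately show ?thesis
    using quotient[of "E - 1"] quotient[of F]
    by (simp add: D_def F_def PB_odd_def mult.commute[of y1 x0] flip: fps_cosh_def
        del: times_divide_eq_left)
qed

end
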